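(* For minimal flat Lorentzian surfaces in a Lorentzian complex space form $\tilde M^2_1(4c)$, the equation of Ricci is a consequence of the equations of Gauss and Codazzi. Precisely: let $c\in\mathbb R$ and let $(M,g,E,\langle\,,\rangle,D,h,J)$ be the data of a Lorentzian surface in a Lorentzian Kähler surface (as defined in the context) such that $(M,g)$ is flat and $h$ is trace-free with respect to $g$ (minimality). If these data satisfy the equation of Gauss and the equation of Codazzi of $\tilde M^2_1(4c)$, then they satisfy the equation of Ricci of $\tilde M^2_1(4c)$.
   Context: A Lorentzian Kähler surface is a Kähler manifold of complex dimension $2$ and complex index $1$ (the real metric has signature $(2,2)$), with metric $\langle\,,\rangle$ and parallel almost complex structure $J$. A Lorentzian complex space form $\tilde M^2_1(4c)$ is one whose curvature tensor is $$\tilde R(X,Y)Z=c\{\langle Y,Z\rangle X-\langle X,Z\rangle Y+\langle JY,Z\rangle JX-\langle JX,Z\rangle JY+2\langle X,JY\rangle JZ\}.$$ A Lorentzian surface $M$ in a Lorentzian Kähler surface has induced metric $g$ of signature $(1,1)$, Levi-Civita connection $\nabla$, normal bundle $E$, second fundamental form $h$, shape operator $A$ and normal connection $D$, with $\tilde\nabla_XY=\nabla_XY+h(X,Y)$ and $\tilde\nabla_X\xi=-A_\xi X+D_X\xi$, where $\langle h(X,Y),\xi\rangle=\langle A_\xi X,Y\rangle$. The data of a Lorentzian surface in a Lorentzian Kähler surface are: a smooth surface $M$ with Lorentzian metric $g$ and Levi-Civita connection $\nabla$; a rank-$2$ real vector bundle $E\to M$ with a fibre metric of signature $(1,1)$ and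 a connection $D$ compatible with it; a symmetric $E$-valued bilinear form $h$ on $TM$, with $A$ defined by $\langle A_\xi X,Y\rangle=\langle h(X,Y),\xi\rangle$; and a bundle endomorphism $J$ of $TM\oplus E$ (with the orthogonal direct sum metric $\langle\,,\rangle$) with $J^2=-\mathrm{id}$, $\langle JU,JV\rangle=\langle U,V\rangle$, which is parallel for the connection $\tilde\nabla$ on $TM\oplus E$ given by $\tilde\nabla_XY=\nabla_XY+h(X,Y)$, $\tilde\nabla_X\xi=-A_\xi X+D_X\xi$ ($X,Y$ tangent to $M$, $\xi$ a section of $E$). For $X,Y,Z,W$ tangent to $M$ and $\xi,\eta$ sections of $E$, with $\tilde R$ given by the formula above on $TM\oplus E$, $R$ and $R^D$ the curvature tensors of $\nabla$ and $D$ (convention $R(X,Y)=\nabla_X\nabla_Y-\nabla_Y\nabla_X-\nabla_{[X,Y]}$), and $(\cdot)^\perp$ the $E$-component, the equations are: Gauss: $\langle R(X,Y)Z,W\rangle=\langle\tilde R(X,Y)Z,W\rangle+\langle h(X,W),h(Y,Z)\rangle-\langle h(X,Z),h(Y,W)\rangle$. Codazzi: $(\tilde R(X,Y)Z)^\perp=(\bar\nabla_Xh)(Y,Z)-(\bar\nabla_Yh)(X,Z)$, where $(\bar\nabla_Xh)(Y,Z)=D_Xh(Y,Z)-h(\nabla_XY,Z)-h(Y,\nabla_XZ)$. Ricci: $\langle R^D(X,Y)\xi,\eta\rangle=\langle\tilde R(X,Y)\xi,\eta\rangle+\langle[A_\xi,A_\eta]X,Y\rangle$. The surface is minimal if its mean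 curvature vector $H=\frac12\operatorname{trace}h$ vanishes identically. *)

theory Defs
  imports "HOL-Analysis.Analysis" "HOL-Library.Function_Algebras"
begin

text \<open>
  Functions into a real vector space form a real vector space under pointwise operations. This
  makes \<open>span\<close> and \<open>subspace\<close> available for tangent vectors, which are functionals on functions,
  and lets vector fields and sections be added and subtracted directly.
\<close>

instantiation "fun" :: (type, real_vector) real_vector
begin

definition scaleR_fun_def: "r *\<^sub>R f = (\<lambda>x. r *\<^sub>R f x)"

instance
  by standard (auto simp: scaleR_fun_def fun_eq_iff scaleR_add_right scaleR_add_left)

end


section \<open>Linear algebra on subspaces\<close>

definition linear_on_subspace :: "'a::real_vector set \<Rightarrow> ('a \<Rightarrow> 'b::real_vector) \<Rightarrow> bool" where
  "linear_on_subspace V f \<longleftrightarrow>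
     (\<forall>x\<in>V. \<forall>y\<in>V. f (x + y) = f x + f y) \<and> (\<forall>r. \<forall>x\<in>V. f (r *\<^sub>R x) = r *\<^sub>R f x)"

definition symmetric_bilinear_on ::
  "'a::real_vector set \<Rightarrow> ('a \<Rightarrow> 'a \<Rightarrow> 'b::real_vector) \<Rightarrow> bool" where
  "symmetric_bilinear_on V b \<longleftrightarrow>
     (\<forall>x\<in>V. linear_on_subspace V (b x)) \<and> (\<forall>x\<in>V. \<forall>y\<in>V. b x y = b y x)"

text \<open>For a symmetric bilinear form, the first five conditions make \<open>e1, e2\<close> linearly independent,
  hence with the last one a basis of \<open>V\<close>.\<close>

definition lorentz_basis ::
  "'a::real_vector set \<Rightarrow> ('a \<Rightarrow> 'a \<Rightarrow> real) \<Rightarrow> 'a \<Rightarrow> 'a \<Rightarrow> bool" where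
  "lorentz_basis V b e1 e2 \<longleftrightarrow>
     e1 \<in> V \<and> e2 \<in> V \<and> b e1 e1 = 1 \<and> b e2 e2 = -1 \<and> b e1 e2 = 0 \<and> span {e1, e2} = V"

definition lorentzian_form :: "'a::real_vector set \<Rightarrow> ('a \<Rightarrow> 'a \<Rightarrow> real) \<Rightarrow> bool" where
  "lorentzian_form V b \<longleftrightarrow> symmetric_bilinear_on V b \<and> (\<exists>e1 e2. lorentz_basis V b e1 e2)"


section \<open>Smooth surfaces\<close>

fun Ck_on :: "nat \<Rightarrow> 'a::real_normed_vector set \<Rightarrow> ('a \<Rightarrow> 'b::real_normed_vector) \<Rightarrow> bool" where
  "Ck_on 0 S f \<longleftrightarrow> continuous_on S f"
| "Ck_on (Suc n) S f \<longleftrightarrow>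
     (\<forall>x\<in>S. f differentiable (at x)) \<and> (\<forall>v. Ck_on n S (\<lambda>x. frechet_derivative f (at x) v))"

text \<open>Only used for open \<open>S\<close>.\<close>

definition smooth_on :: "'a::real_normed_vector set \<Rightarrow> ('a \<Rightarrow> 'b::real_normed_vector) \<Rightarrow> bool" where
  "smooth_on S f \<longleftrightarrow> (\<forall>n. Ck_on n S f)"

text \<open>The surface \<open>M\<close> is the whole type \<open>'m\<close>; a chart is a pair \<open>(U, \<phi>)\<close>, where \<open>\<phi>\<close> is only
  relevant on \<open>U\<close>.\<close>

type_synonym 'm atlas = "('m set \<times> ('m \<Rightarrow> real ^ 2)) set"

definition smooth_surface ::
  "'m::{t2_space, second_countable_topology} atlas \<Rightarrow> bool" where
  "smooth_surface \<A> \<longleftrightarrow>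
     (\<Union>(U, \<phi>)\<in>\<A>. U) = UNIV \<and>
     (\<forall>(U, \<phi>)\<in>\<A>. open U \<and> open (\<phi> ` U) \<and> homeomorphism U (\<phi> ` U) \<phi> (inv_into U \<phi>)) \<and>
     (\<forall>(U, \<phi>)\<in>\<A>. \<forall>(V, \<psi>)\<in>\<A>. smooth_on (\<phi> ` (U \<inter> V)) (\<psi> \<circ> inv_into U \<phi>))"

definition smooth_map_on ::
  "'m atlas \<Rightarrow> 'm set \<Rightarrow> ('m \<Rightarrow> 'b::real_normed_vector) \<Rightarrow> bool" where
  "smooth_map_on \<A> W f \<longleftrightarrow> (\<forall>(U, \<phi>)\<in>\<A>. smooth_on (\<phi> ` (U \<inter> W)) (f \<circ> inv_into U \<phi>))"

definition smooth_functions :: "'m atlas \<Rightarrow> ('m \<Rightarrow> real) set" where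
  "smooth_functions \<A> = {f. smooth_map_on \<A> UNIV f}"


section \<open>Tangent vectors and vector fields\<close>

type_synonym 'm tangent = "('m \<Rightarrow> real) \<Rightarrow> real"
type_synonym 'm vfield = "'m \<Rightarrow> 'm tangent"

text \<open>The tangent space at \<open>p\<close> consists of the derivations at \<open>p\<close> of the algebra of smooth
  functions. Derivations are totalised by \<open>0\<close> outside that algebra, so that they are determined by
  their values on smooth functions.\<close>

definition tangent_space :: "'m atlas \<Rightarrow> 'm \<Rightarrow> 'm tangent set" where
  "tangent_space \<A> p = {v.
     (\<forall>f\<in>smooth_functions \<A>. \<forall>g\<in>smooth_functions \<A>.
        v (\<lambda>q. f q + g q) = v f + v g \<and>
        v (\<lambda>q. f q * g q) = v f * g p + f p * v g) \<and>
     (\<forall>r. \<forall>f\<in>smooth_functions \<A>. v (\<lambda>q. r * f q) = r * v f) \<and>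
     (\<forall>f. f \<notin> smooth_functions \<A> \<longrightarrow> v f = 0)}"

definition vector_fields :: "'m atlas \<Rightarrow> 'm vfield set" where
  "vector_fields \<A> = {X. (\<forall>p. X p \<in> tangent_space \<A> p) \<and>
     (\<forall>f\<in>smooth_functions \<A>. (\<lambda>p. X p f) \<in> smooth_functions \<A>)}"

definition lie_bracket :: "'m vfield \<Rightarrow> 'm vfield \<Rightarrow> 'm vfield" where
  "lie_bracket X Y = (\<lambda>p f. X p (\<lambda>q. Y q f) - Y p (\<lambda>q. X q f))"


section \<open>Vector bundles of rank two and connections\<close>

text \<open>A bundle is given by its fibres, as subspaces \<open>E p\<close> of some real vector space (no loss of
  generality: embed the fibres in their direct sum; the ambient space carries no further meaning),
  and by a bundle atlas of local trivialisations \<open>(U, \<Phi>)\<close>, with \<open>\<Phi> p\<close> an isomorphism of \<open>E p\<close>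
  onto \<open>\<real>\<^sup>2\<close> for \<open>p \<in> U\<close> and smooth transition functions.\<close>

type_synonym ('m, 'v) bundle_atlas = "('m set \<times> ('m \<Rightarrow> 'v \<Rightarrow> real ^ 2)) set"

definition rank2_bundle ::
  "'m::topological_space atlas \<Rightarrow> ('m \<Rightarrow> 'v::real_vector set) \<Rightarrow> ('m, 'v) bundle_atlas \<Rightarrow> bool" where
  "rank2_bundle \<A> E \<T> \<longleftrightarrow>
     (\<forall>p. subspace (E p)) \<and>
     (\<Union>(U, \<Phi>)\<in>\<T>. U) = UNIV \<and>
     (\<forall>(U, \<Phi>)\<in>\<T>. open U \<and>
        (\<forall>p\<in>U. linear_on_subspace (E p) (\<Phi> p) \<and> bij_betw (\<Phi> p) (E p) UNIV)) \<and>
     (\<forall>(U, \<Phi>)\<in>\<T>. \<forall>(V, \<Psi>)\<in>\<T>. \<forall>w.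
        smooth_map_on \<A> (U \<inter> V) (\<lambda>p. \<Psi> p (inv_into (E p) (\<Phi> p) w)))"

definition sections ::
  "'m atlas \<Rightarrow> ('m \<Rightarrow> 'v::real_vector set) \<Rightarrow> ('m, 'v) bundle_atlas \<Rightarrow> ('m \<Rightarrow> 'v) set" where
  "sections \<A> E \<T> = {\<xi>. (\<forall>p. \<xi> p \<in> E p) \<and>
     (\<forall>(U, \<Phi>)\<in>\<T>. smooth_map_on \<A> U (\<lambda>p. \<Phi> p (\<xi> p)))}"

text \<open>A connection on the bundle whose module of smooth sections is \<open>\<Gamma>\<close>; used both for the tangent
  bundle and for \<open>E\<close>.\<close>

definition is_connection ::
  "'m atlas \<Rightarrow> ('m \<Rightarrow> 'w::real_vector) set \<Rightarrow>
   ('m vfield \<Rightarrow> ('m \<Rightarrow> 'w) \<Rightarrow> ('m \<Rightarrow> 'w)) \<Rightarrow> bool" where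
  "is_connection \<A> \<Gamma> D \<longleftrightarrow>
     (\<forall>X\<in>vector_fields \<A>. \<forall>s\<in>\<Gamma>. D X s \<in> \<Gamma>) \<and>
     (\<forall>X\<in>vector_fields \<A>. \<forall>Y\<in>vector_fields \<A>. \<forall>s\<in>\<Gamma>. D (X + Y) s = D X s + D Y s) \<and>
     (\<forall>f\<in>smooth_functions \<A>. \<forall>X\<in>vector_fields \<A>. \<forall>s\<in>\<Gamma>.
        D (\<lambda>p. f p *\<^sub>R X p) s = (\<lambda>p. f p *\<^sub>R D X s p)) \<and>
     (\<forall>X\<in>vector_fields \<A>. \<forall>s\<in>\<Gamma>. \<forall>t\<in>\<Gamma>. D X (s + t) = D X s + D X t) \<and>
     (\<forall>f\<in>smooth_functions \<A>. \<forall>X\<in>vector_fields \<A>. \<forall>s\<in>\<Gamma>.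
        D X (\<lambda>p. f p *\<^sub>R s p) = (\<lambda>p. X p f *\<^sub>R s p + f p *\<^sub>R D X s p))"

definition curvature ::
  "('m vfield \<Rightarrow> ('m \<Rightarrow> 'w::real_vector) \<Rightarrow> ('m \<Rightarrow> 'w)) \<Rightarrow>
   'm vfield \<Rightarrow> 'm vfield \<Rightarrow> ('m \<Rightarrow> 'w) \<Rightarrow> ('m \<Rightarrow> 'w)" where
  "curvature D X Y s = D X (D Y s) - D Y (D X s) - D (lie_bracket X Y) s"

definition lorentzian_bundle_metric ::
  "'m atlas \<Rightarrow> ('m \<Rightarrow> 'w::real_vector set) \<Rightarrow> ('m \<Rightarrow> 'w) set \<Rightarrow>
   ('m \<Rightarrow> 'w \<Rightarrow> 'w \<Rightarrow> real) \<Rightarrow> bool" where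
  "lorentzian_bundle_metric \<A> F \<Gamma> k \<longleftrightarrow>
     (\<forall>p. lorentzian_form (F p) (k p)) \<and>
     (\<forall>s\<in>\<Gamma>. \<forall>t\<in>\<Gamma>. (\<lambda>p. k p (s p) (t p)) \<in> smooth_functions \<A>)"

definition metric_compatible ::
  "'m atlas \<Rightarrow> ('m \<Rightarrow> 'w::real_vector) set \<Rightarrow> ('m \<Rightarrow> 'w \<Rightarrow> 'w \<Rightarrow> real) \<Rightarrow>
   ('m vfield \<Rightarrow> ('m \<Rightarrow> 'w) \<Rightarrow> ('m \<Rightarrow> 'w)) \<Rightarrow> bool" where
  "metric_compatible \<A> \<Gamma> k D \<longleftrightarrow>
     (\<forall>X\<in>vector_fields \<A>. \<forall>s\<in>\<Gamma>. \<forall>t\<in>\<Gamma>. \<forall>p.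
        X p (\<lambda>q. k q (s q) (t q)) = k p (D X s p) (t p) + k p (s p) (D X t p))"

definition levi_civita ::
  "'m atlas \<Rightarrow> ('m \<Rightarrow> 'm tangent \<Rightarrow> 'm tangent \<Rightarrow> real) \<Rightarrow>
   ('m vfield \<Rightarrow> 'm vfield \<Rightarrow> 'm vfield) \<Rightarrow> bool" where
  "levi_civita \<A> g N \<longleftrightarrow>
     is_connection \<A> (vector_fields \<A>) N \<and>
     metric_compatible \<A> (vector_fields \<A>) g N \<and>
     (\<forall>X\<in>vector_fields \<A>. \<forall>Y\<in>vector_fields \<A>. N X Y - N Y X = lie_bracket X Y)"


section \<open>Surface data\<close>

definition shape_operator ::
  "'m atlas \<Rightarrow> ('m \<Rightarrow> 'm tangent \<Rightarrow> 'm tangent \<Rightarrow> real) \<Rightarrow> ('m \<Rightarrow> 'v \<Rightarrow> 'v \<Rightarrow> real) \<Rightarrow>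
   ('m \<Rightarrow> 'm tangent \<Rightarrow> 'm tangent \<Rightarrow> 'v) \<Rightarrow> 'm \<Rightarrow> 'v \<Rightarrow> 'm tangent \<Rightarrow> 'm tangent" where
  "shape_operator \<A> g k h p \<xi> x =
     (THE a. a \<in> tangent_space \<A> p \<and> (\<forall>y\<in>tangent_space \<A> p. g p a y = k p (h p x y) \<xi>))"

text \<open>The fibre of \<open>TM \<oplus> E\<close> at \<open>p\<close> is \<open>tangent_space \<A> p \<times> E p\<close>; a tangent vector \<open>x\<close> and a
  normal vector \<open>\<xi>\<close> appear in it as \<open>(x, 0)\<close> and \<open>(0, \<xi>)\<close>.\<close>

definition sum_metric ::
  "('m \<Rightarrow> 'm tangent \<Rightarrow> 'm tangent \<Rightarrow> real) \<Rightarrow> ('m \<Rightarrow> 'v \<Rightarrow> 'v \<Rightarrow> real) \<Rightarrow>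
   'm \<Rightarrow> 'm tangent \<times> 'v \<Rightarrow> 'm tangent \<times> 'v \<Rightarrow> real" where
  "sum_metric g k p u w = g p (fst u) (fst w) + k p (snd u) (snd w)"

definition sum_sections ::
  "'m atlas \<Rightarrow> ('m \<Rightarrow> 'v::real_vector set) \<Rightarrow> ('m, 'v) bundle_atlas \<Rightarrow>
   ('m \<Rightarrow> 'm tangent \<times> 'v) set" where
  "sum_sections \<A> E \<T> = {U. fst \<circ> U \<in> vector_fields \<A> \<and> snd \<circ> U \<in> sections \<A> E \<T>}"

definition sum_connection ::
  "'m atlas \<Rightarrow> ('m \<Rightarrow> 'm tangent \<Rightarrow> 'm tangent \<Rightarrow> real) \<Rightarrow>
   ('m vfield \<Rightarrow> 'm vfield \<Rightarrow> 'm vfield) \<Rightarrow>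
   ('m \<Rightarrow> 'v::real_vector \<Rightarrow> 'v \<Rightarrow> real) \<Rightarrow> ('m vfield \<Rightarrow> ('m \<Rightarrow> 'v) \<Rightarrow> ('m \<Rightarrow> 'v)) \<Rightarrow>
   ('m \<Rightarrow> 'm tangent \<Rightarrow> 'm tangent \<Rightarrow> 'v) \<Rightarrow>
   'm vfield \<Rightarrow> ('m \<Rightarrow> 'm tangent \<times> 'v) \<Rightarrow> ('m \<Rightarrow> 'm tangent \<times> 'v)" where
  "sum_connection \<A> g N k D h X U = (\<lambda>p.
     (N X (fst \<circ> U) p - shape_operator \<A> g k h p (snd (U p)) (X p),
      h p (X p) (fst (U p)) + D X (snd \<circ> U) p))"

definition lorentzian_surface_data ::
  "'m::{t2_space, second_countable_topology} atlas \<Rightarrow>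
   ('m \<Rightarrow> 'm tangent \<Rightarrow> 'm tangent \<Rightarrow> real) \<Rightarrow>
   ('m vfield \<Rightarrow> 'm vfield \<Rightarrow> 'm vfield) \<Rightarrow>
   ('m \<Rightarrow> 'v::real_vector set) \<Rightarrow> ('m, 'v) bundle_atlas \<Rightarrow>
   ('m \<Rightarrow> 'v \<Rightarrow> 'v \<Rightarrow> real) \<Rightarrow> ('m vfield \<Rightarrow> ('m \<Rightarrow> 'v) \<Rightarrow> ('m \<Rightarrow> 'v)) \<Rightarrow>
   ('m \<Rightarrow> 'm tangent \<Rightarrow> 'm tangent \<Rightarrow> 'v) \<Rightarrow>
   ('m \<Rightarrow> 'm tangent \<times> 'v \<Rightarrow> 'm tangent \<times> 'v) \<Rightarrow> bool" where
  "lorentzian_surface_data \<A> g N E \<T> k D h J \<longleftrightarrow>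
     smooth_surface \<A> \<and>
     lorentzian_bundle_metric \<A> (tangent_space \<A>) (vector_fields \<A>) g \<and>
     levi_civita \<A> g N \<and>
     rank2_bundle \<A> E \<T> \<and>
     lorentzian_bundle_metric \<A> E (sections \<A> E \<T>) k \<and>
     is_connection \<A> (sections \<A> E \<T>) D \<and>
     metric_compatible \<A> (sections \<A> E \<T>) k D \<and>
     (\<forall>p. symmetric_bilinear_on (tangent_space \<A> p) (h p)) \<and>
     (\<forall>p. \<forall>x\<in>tangent_space \<A> p. \<forall>y\<in>tangent_space \<A> p. h p x y \<in> E p) \<and>
     (\<forall>X\<in>vector_fields \<A>. \<forall>Y\<in>vector_fields \<A>. (\<lambda>p. h p (X p) (Y p)) \<in> sections \<A> E \<T>) \<and>
     (\<forall>p. linear_on_subspace (tangent_space \<A> p \<times> E p) (J p) \<and>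
        (\<forall>u\<in>tangent_space \<A> p \<times> E p.
           J p u \<in> tangent_space \<A> p \<times> E p \<and> J p (J p u) = - u \<and>
           (\<forall>w\<in>tangent_space \<A> p \<times> E p.
              sum_metric g k p (J p u) (J p w) = sum_metric g k p u w))) \<and>
     (\<forall>U\<in>sum_sections \<A> E \<T>. (\<lambda>p. J p (U p)) \<in> sum_sections \<A> E \<T>) \<and>
     (\<forall>X\<in>vector_fields \<A>. \<forall>U\<in>sum_sections \<A> E \<T>. \<forall>p.
        sum_connection \<A> g N k D h X (\<lambda>q. J q (U q)) p =
        J p (sum_connection \<A> g N k D h X U p))"

definition flat :: "'m atlas \<Rightarrow> ('m vfield \<Rightarrow> 'm vfield \<Rightarrow> 'm vfield) \<Rightarrow> bool" where
  "flat \<A> N \<longleftrightarrow>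
     (\<forall>X\<in>vector_fields \<A>. \<forall>Y\<in>vector_fields \<A>. \<forall>Z\<in>vector_fields \<A>. curvature N X Y Z = 0)"

text \<open>The metric trace of a symmetric bilinear map \<open>b\<close> is \<open>b e1 e1 - b e2 e2\<close>, for any
  pseudo-orthonormal basis; the value does not depend on the basis.\<close>

definition mean_curvature_vector ::
  "'m atlas \<Rightarrow> ('m \<Rightarrow> 'm tangent \<Rightarrow> 'm tangent \<Rightarrow> real) \<Rightarrow>
   ('m \<Rightarrow> 'm tangent \<Rightarrow> 'm tangent \<Rightarrow> 'v::real_vector) \<Rightarrow> 'm \<Rightarrow> 'v" where
  "mean_curvature_vector \<A> g h p =
     (1/2) *\<^sub>R (THE t. \<forall>e1 e2. lorentz_basis (tangent_space \<A> p) (g p) e1 e2 \<longrightarrow>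
                       t = h p e1 e1 - h p e2 e2)"

definition minimal ::
  "'m atlas \<Rightarrow> ('m \<Rightarrow> 'm tangent \<Rightarrow> 'm tangent \<Rightarrow> real) \<Rightarrow>
   ('m \<Rightarrow> 'm tangent \<Rightarrow> 'm tangent \<Rightarrow> 'v::real_vector) \<Rightarrow> bool" where
  "minimal \<A> g h \<longleftrightarrow> (\<forall>p. mean_curvature_vector \<A> g h p = 0)"


section \<open>The fundamental equations\<close>

text \<open>\<open>space_form_curvature c b j x y z\<close> is the curvature tensor \<open>R(x, y) z\<close> of constant holomorphic sectional
  curvature \<open>4c\<close>, for a scalar product \<open>b\<close> and a complex structure \<open>j\<close>.\<close>

definition space_form_curvature ::
  "real \<Rightarrow> ('a::real_vector \<Rightarrow> 'a \<Rightarrow> real) \<Rightarrow> ('a \<Rightarrow> 'a) \<Rightarrow> 'a \<Rightarrow> 'a \<Rightarrow> 'a \<Rightarrow> 'a" where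
  "space_form_curvature c b j x y z =
     c *\<^sub>R (b y z *\<^sub>R x - b x z *\<^sub>R y + b (j y) z *\<^sub>R j x - b (j x) z *\<^sub>R j y
            + (2 * b x (j y)) *\<^sub>R j z)"

definition gauss_equation ::
  "real \<Rightarrow> 'm atlas \<Rightarrow> ('m \<Rightarrow> 'm tangent \<Rightarrow> 'm tangent \<Rightarrow> real) \<Rightarrow>
   ('m vfield \<Rightarrow> 'm vfield \<Rightarrow> 'm vfield) \<Rightarrow> ('m \<Rightarrow> 'v::real_vector \<Rightarrow> 'v \<Rightarrow> real) \<Rightarrow>
   ('m \<Rightarrow> 'm tangent \<Rightarrow> 'm tangent \<Rightarrow> 'v) \<Rightarrow>
   ('m \<Rightarrow> 'm tangent \<times> 'v \<Rightarrow> 'm tangent \<times> 'v) \<Rightarrow> bool" where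
  "gauss_equation c \<A> g N k h J \<longleftrightarrow>
     (\<forall>X\<in>vector_fields \<A>. \<forall>Y\<in>vector_fields \<A>. \<forall>Z\<in>vector_fields \<A>. \<forall>W\<in>vector_fields \<A>. \<forall>p.
        g p (curvature N X Y Z p) (W p) =
        sum_metric g k p
          (space_form_curvature c (sum_metric g k p) (J p) (X p, 0) (Y p, 0) (Z p, 0)) (W p, 0)
        + k p (h p (X p) (W p)) (h p (Y p) (Z p)) - k p (h p (X p) (Z p)) (h p (Y p) (W p)))"

definition covariant_deriv_h ::
  "('m vfield \<Rightarrow> 'm vfield \<Rightarrow> 'm vfield) \<Rightarrow>
   ('m vfield \<Rightarrow> ('m \<Rightarrow> 'v::real_vector) \<Rightarrow> ('m \<Rightarrow> 'v)) \<Rightarrow>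
   ('m \<Rightarrow> 'm tangent \<Rightarrow> 'm tangent \<Rightarrow> 'v) \<Rightarrow>
   'm vfield \<Rightarrow> 'm vfield \<Rightarrow> 'm vfield \<Rightarrow> 'm \<Rightarrow> 'v" where
  "covariant_deriv_h N D h X Y Z p =
     D X (\<lambda>q. h q (Y q) (Z q)) p - h p (N X Y p) (Z p) - h p (Y p) (N X Z p)"

definition codazzi_equation ::
  "real \<Rightarrow> 'm atlas \<Rightarrow> ('m \<Rightarrow> 'm tangent \<Rightarrow> 'm tangent \<Rightarrow> real) \<Rightarrow>
   ('m vfield \<Rightarrow> 'm vfield \<Rightarrow> 'm vfield) \<Rightarrow> ('m \<Rightarrow> 'v::real_vector \<Rightarrow> 'v \<Rightarrow> real) \<Rightarrow>
   ('m vfield \<Rightarrow> ('m \<Rightarrow> 'v) \<Rightarrow> ('m \<Rightarrow> 'v)) \<Rightarrow>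
   ('m \<Rightarrow> 'm tangent \<Rightarrow> 'm tangent \<Rightarrow> 'v) \<Rightarrow>
   ('m \<Rightarrow> 'm tangent \<times> 'v \<Rightarrow> 'm tangent \<times> 'v) \<Rightarrow> bool" where
  "codazzi_equation c \<A> g N k D h J \<longleftrightarrow>
     (\<forall>X\<in>vector_fields \<A>. \<forall>Y\<in>vector_fields \<A>. \<forall>Z\<in>vector_fields \<A>. \<forall>p.
        snd (space_form_curvature c (sum_metric g k p) (J p) (X p, 0) (Y p, 0) (Z p, 0)) =
        covariant_deriv_h N D h X Y Z p - covariant_deriv_h N D h Y X Z p)"

definition ricci_equation ::
  "real \<Rightarrow> 'm atlas \<Rightarrow> ('m \<Rightarrow> 'm tangent \<Rightarrow> 'm tangent \<Rightarrow> real) \<Rightarrow>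
   ('m \<Rightarrow> 'v::real_vector set) \<Rightarrow> ('m, 'v) bundle_atlas \<Rightarrow> ('m \<Rightarrow> 'v \<Rightarrow> 'v \<Rightarrow> real) \<Rightarrow>
   ('m vfield \<Rightarrow> ('m \<Rightarrow> 'v) \<Rightarrow> ('m \<Rightarrow> 'v)) \<Rightarrow>
   ('m \<Rightarrow> 'm tangent \<Rightarrow> 'm tangent \<Rightarrow> 'v) \<Rightarrow>
   ('m \<Rightarrow> 'm tangent \<times> 'v \<Rightarrow> 'm tangent \<times> 'v) \<Rightarrow> bool" where
  "ricci_equation c \<A> g E \<T> k D h J \<longleftrightarrow>
     (\<forall>X\<in>vector_fields \<A>. \<forall>Y\<in>vector_fields \<A>. \<forall>\<xi>\<in>sections \<A> E \<T>. \<forall>\<eta>\<in>sections \<A> E \<T>. \<forall>p.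
        let A = shape_operator \<A> g k h p in
        k p (curvature D X Y \<xi> p) (\<eta> p) =
        sum_metric g k p
          (space_form_curvature c (sum_metric g k p) (J p) (X p, 0) (Y p, 0) (0, \<xi> p)) (0, \<eta> p)
        + g p (A (\<xi> p) (A (\<eta> p) (X p)) - A (\<eta> p) (A (\<xi> p) (X p))) (Y p))"

end

theory Submission
  imports Defs
begin

text \<open>
  Let \<open>\<D>\<close> be the connection on \<open>TM \<oplus> E\<close>, let \<open>C(X, Y)\<close> be its curvature and let \<open>R(X, Y)\<close> be the
  curvature tensor of the complex space form. For tangent \<open>Z\<close>, the tangential part of \<open>C(X, Y) Z\<close>
  is the content of the equation of Gauss and the normal part that of the equation of Codazzi, so
  the two hypotheses say \<open>C(X, Y) Z = R(X, Y) Z\<close>. The equation of Ricci is the normal part of the same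
  identity for normal arguments. Now \<open>C(X, Y)\<close> commutes with \<open>J\<close> because \<open>J\<close> is parallel, and
  \<open>R(X, Y)\<close> commutes with \<open>J\<close> by its formula. Hence the identity passes from \<open>Z\<close> to \<open>J Z\<close>, and by
  subtracting the tangent case to the normal part \<open>\<zeta>\<close> of \<open>J Z\<close>
  (lemma \<open>ricci_for_normal_part\<close>).

  The signature makes every normal vector such a \<open>\<zeta>\<close>. Write \<open>J \<eta> = G \<eta> + Q \<eta>\<close> for normal \<open>\<eta>\<close>,
  with \<open>G \<eta>\<close> tangent and \<open>Q \<eta>\<close> normal. The operator \<open>Q\<close> is skew on the Lorentzian plane \<open>E p\<close>,
  so \<open>Q\<^sup>2 = \<beta>\<^sup>2\<close> (lemma \<open>skew_operator_square\<close>), and the normal part of \<open>J (J \<eta>) = - \<eta>\<close> says that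
  \<open>J (G \<eta>)\<close> has normal part \<open>- (1 + \<beta>\<^sup>2) \<eta>\<close>, a nonzero multiple of \<open>\<eta>\<close>. On a definite plane the factor
  would be \<open>- (1 - \<beta>\<^sup>2)\<close>, which vanishes at complex points.

  To transfer the result from \<open>\<zeta>\<close> to \<open>\<eta>\<close> one could divide by the factor, which requires its
  smoothness. The skew symmetry of the curvature of \<open>D\<close> and of \<open>R(X, Y)\<close> avoids this: \<open>\<zeta>\<close> is moved to
  the slot of the equation of Ricci that is not differentiated, where only its value at the
  point matters. Likewise, Gauss and Codazzi are only paired with vector fields obtained from
  sections of \<open>E\<close> by applying \<open>J\<close>, so that no local frames or extensions of tangent vectors to
  vector fields enter.
\<close>

section \<open>Linear algebra on subspaces\<close>

lemma linear_on_subspace_add: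
  "linear_on_subspace V f \<Longrightarrow> x \<in> V \<Longrightarrow> y \<in> V \<Longrightarrow> f (x + y) = f x + f y"
  by (simp add: linear_on_subspace_def)

lemma linear_on_subspace_scale:
  "linear_on_subspace V f \<Longrightarrow> x \<in> V \<Longrightarrow> f (r *\<^sub>R x) = r *\<^sub>R f x"
  by (simp add: linear_on_subspace_def)

lemma linear_on_subspace_minus:
  "linear_on_subspace V f \<Longrightarrow> x \<in> V \<Longrightarrow> f (- x) = - f x"
  using linear_on_subspace_scale[of V f x "-1"] by simp

lemma linear_on_subspace_diff:
  assumes "subspace V" "linear_on_subspace V f" "x \<in> V" "y \<in> V"
  shows "f (x - y) = f x - f y"
  using assms linear_on_subspace_add[of V f x "- y"] linear_on_subspace_minus[of V f y]
  by (simp add: subspace_neg)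

lemma linear_on_subspace_zero:
  "subspace V \<Longrightarrow> linear_on_subspace V f \<Longrightarrow> f 0 = 0"
  using linear_on_subspace_scale[of V f 0 0] by (simp add: subspace_0)

locale symmetric_bilinear_space =
  fixes V :: "'a::real_vector set" and b :: "'a \<Rightarrow> 'a \<Rightarrow> 'b::real_vector"
  assumes subspace: "subspace V" and symmetric_bilinear: "symmetric_bilinear_on V b"
begin

lemma linear: "x \<in> V \<Longrightarrow> linear_on_subspace V (b x)"
  using symmetric_bilinear by (simp add: symmetric_bilinear_on_def)

lemma commute: "x \<in> V \<Longrightarrow> y \<in> V \<Longrightarrow> b x y = b y x"
  using symmetric_bilinear by (simp add: symmetric_bilinear_on_def)

lemma membership:
  "0 \<in> V" "x \<in> V \<Longrightarrow> y \<in> V \<Longrightarrow> x + y \<in> V" "x \<in> V \<Longrightarrow> y \<in> V \<Longrightarrow> x - y \<in> V"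
  "x \<in> V \<Longrightarrow> - x \<in> V" "x \<in> V \<Longrightarrow> r *\<^sub>R x \<in> V"
  using subspace by (auto intro: subspace_0 subspace_add subspace_diff subspace_neg subspace_scale)

lemma right:
  "x \<in> V \<Longrightarrow> y \<in> V \<Longrightarrow> z \<in> V \<Longrightarrow> b x (y + z) = b x y + b x z"
  "x \<in> V \<Longrightarrow> y \<in> V \<Longrightarrow> z \<in> V \<Longrightarrow> b x (y - z) = b x y - b x z"
  "x \<in> V \<Longrightarrow> y \<in> V \<Longrightarrow> b x (- y) = - b x y"
  "x \<in> V \<Longrightarrow> y \<in> V \<Longrightarrow> b x (r *\<^sub>R y) = r *\<^sub>R b x y"
  "x \<in> V \<Longrightarrow> b x 0 = 0"
  using linear[of x] subspace
  by (auto intro: linear_on_subspace_add linear_on_subspace_diff linear_on_subspace_minus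
      linear_on_subspace_scale linear_on_subspace_zero)

lemma left:
  "x \<in> V \<Longrightarrow> y \<in> V \<Longrightarrow> z \<in> V \<Longrightarrow> b (y + z) x = b y x + b z x"
  "x \<in> V \<Longrightarrow> y \<in> V \<Longrightarrow> z \<in> V \<Longrightarrow> b (y - z) x = b y x - b z x"
  "x \<in> V \<Longrightarrow> y \<in> V \<Longrightarrow> b (- y) x = - b y x"
  "x \<in> V \<Longrightarrow> y \<in> V \<Longrightarrow> b (r *\<^sub>R y) x = r *\<^sub>R b y x"
  "x \<in> V \<Longrightarrow> b 0 x = 0"
  using right[of x] membership by (simp_all add: commute[of _ x])

lemmas bilinear_simps = membership left right

end

locale lorentzian_plane =
  fixes V :: "'a::real_vector set" and b :: "'a \<Rightarrow> 'a \<Rightarrow> real"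
  assumes lorentzian: "lorentzian_form V b"
begin

sublocale symmetric_bilinear_space V b
proof
  show "subspace V" "symmetric_bilinear_on V b"
    using lorentzian by (auto simp: lorentzian_form_def lorentz_basis_def)
qed

lemma basis_expansion:
  assumes "lorentz_basis V b e1 e2" "x \<in> V"
  shows "x = b x e1 *\<^sub>R e1 - b x e2 *\<^sub>R e2"
proof -
  have e: "e1 \<in> V" "e2 \<in> V" "b e1 e1 = 1" "b e2 e2 = -1" "b e1 e2 = 0" "b e2 e1 = 0"
    and sp: "span {e1, e2} = V"
    using assms commute[of e1 e2] by (auto simp: lorentz_basis_def)
  have "x \<in> span {e1, e2}"
    using sp assms by simp
  then obtain r s where x: "x = r *\<^sub>R e1 + s *\<^sub>R e2"
    by (auto simp: span_insert algebra_simps)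
  show ?thesis
    using e by (simp add: x bilinear_simps)
qed

lemma nondegenerate:
  assumes "x \<in> V" "y \<in> V" "\<And>z. z \<in> V \<Longrightarrow> b x z = b y z"
  shows "x = y"
proof -
  obtain e1 e2 where e: "lorentz_basis V b e1 e2"
    using lorentzian by (auto simp: lorentzian_form_def)
  then have "e1 \<in> V" "e2 \<in> V"
    by (auto simp: lorentz_basis_def)
  then show ?thesis
    using basis_expansion[OF e assms(1)] basis_expansion[OF e assms(2)] assms(3) by metis
qed

text \<open>A Riesz representation; it makes the definite description in the shape operator meaningful.\<close>

lemma representation:
  assumes "linear_on_subspace V \<phi>"
  shows "\<exists>!a. a \<in> V \<and> (\<forall>y\<in>V. b a y = \<phi> y)"
proof -
  obtain e1 e2 where e: "lorentz_basis V b e1 e2"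
    using lorentzian by (auto simp: lorentzian_form_def)
  then have eV: "e1 \<in> V" "e2 \<in> V"
    by (auto simp: lorentz_basis_def)
  let ?a = "\<phi> e1 *\<^sub>R e1 - \<phi> e2 *\<^sub>R e2"
  have "b ?a y = \<phi> y" if "y \<in> V" for y
  proof -
    have "\<phi> y = \<phi> (b y e1 *\<^sub>R e1 - b y e2 *\<^sub>R e2)"
      using basis_expansion[OF e that] by simp
    also have "\<dots> = b y e1 * \<phi> e1 - b y e2 * \<phi> e2"
      using eV by (simp add: linear_on_subspace_diff[OF subspace assms] membership
          linear_on_subspace_scale[OF assms])
    also have "\<dots> = b ?a y"
      using eV that by (simp add: bilinear_simps commute[of y])
    finally show ?thesis by simp
  qed
  then show ?thesis
    using nondegenerate eV by (intro ex1I[of _ ?a]) (auto simp: membership)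
qed

text \<open>In a Lorentzian basis a skew operator has the matrix \<open>((0, \<beta>), (\<beta>, 0))\<close>. The sign of the
  square is what the signature decides: for a definite plane it would be negative.\<close>

lemma skew_operator_square:
  assumes Q: "linear_on_subspace V Q" "\<And>x. x \<in> V \<Longrightarrow> Q x \<in> V"
    and skew: "\<And>x y. x \<in> V \<Longrightarrow> y \<in> V \<Longrightarrow> b (Q x) y = - b x (Q y)"
  shows "\<exists>\<beta>. \<forall>x\<in>V. Q (Q x) = \<beta>\<^sup>2 *\<^sub>R x"
proof -
  obtain e1 e2 where e: "lorentz_basis V b e1 e2"
    using lorentzian by (auto simp: lorentzian_form_def)
  then have eV: "e1 \<in> V" "e2 \<in> V"
    by (auto simp: lorentz_basis_def)
  define \<beta> where "\<beta> = - b (Q e1) e2"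
  have diag: "b (Q x) x = 0" if "x \<in> V" for x
    using skew[OF that that] commute[OF Q(2)[OF that] that] by simp
  have "b (Q e2) e1 = \<beta>"
    unfolding \<beta>_def
    using skew[OF eV(2,1)] commute[OF eV(2) Q(2)[OF eV(1)]] by simp
  then have Qe: "Q e1 = \<beta> *\<^sub>R e2" "Q e2 = \<beta> *\<^sub>R e1"
    using basis_expansion[OF e Q(2)[OF eV(1)]] basis_expansion[OF e Q(2)[OF eV(2)]] diag eV
    by (auto simp: \<beta>_def)
  have QQe: "Q (Q e1) = \<beta>\<^sup>2 *\<^sub>R e1" "Q (Q e2) = \<beta>\<^sup>2 *\<^sub>R e2"
    using eV by (simp_all add: Qe linear_on_subspace_scale[OF Q(1)] power2_eq_square)
  have "Q (Q x) = \<beta>\<^sup>2 *\<^sub>R x" if "x \<in> V" for x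
  proof -
    define r s where "r = b x e1" and "s = b x e2"
    have x: "x = r *\<^sub>R e1 - s *\<^sub>R e2"
      unfolding r_def s_def by (rule basis_expansion[OF e that])
    have "Q (Q x) = r *\<^sub>R Q (Q e1) - s *\<^sub>R Q (Q e2)"
      using eV Q(2) by (simp add: x linear_on_subspace_diff[OF subspace Q(1)] membership
          linear_on_subspace_scale[OF Q(1)])
    then show ?thesis
      unfolding QQe by (simp add: x scaleR_diff_right mult.commute)
  qed
  then show ?thesis by blast
qed

end

section \<open>The curvature tensor of a complex space form\<close>

locale hermitian_space = symmetric_bilinear_space V b
  for V :: "'a::real_vector set" and b :: "'a \<Rightarrow> 'a \<Rightarrow> real" +
  fixes j :: "'a \<Rightarrow> 'a"
  assumes j_linear: "linear_on_subspace V j"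
    and j_closed: "x \<in> V \<Longrightarrow> j x \<in> V"
    and j_square: "x \<in> V \<Longrightarrow> j (j x) = - x"
    and j_isometry: "x \<in> V \<Longrightarrow> y \<in> V \<Longrightarrow> b (j x) (j y) = b x y"
begin

lemma j_simps:
  "x \<in> V \<Longrightarrow> y \<in> V \<Longrightarrow> j (x + y) = j x + j y"
  "x \<in> V \<Longrightarrow> y \<in> V \<Longrightarrow> j (x - y) = j x - j y"
  "x \<in> V \<Longrightarrow> j (r *\<^sub>R x) = r *\<^sub>R j x"
  "x \<in> V \<Longrightarrow> j (- x) = - j x"
  using j_linear subspace
  by (auto intro: linear_on_subspace_add linear_on_subspace_diff linear_on_subspace_minus
      linear_on_subspace_scale)

lemma j_skew:
  assumes "x \<in> V" "y \<in> V"
  shows "b (j x) y = - b x (j y)"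
  using j_isometry[of "j x" y] assms by (simp add: j_closed j_square bilinear_simps)

lemma space_form_curvature_closed:
  "x \<in> V \<Longrightarrow> y \<in> V \<Longrightarrow> z \<in> V \<Longrightarrow> space_form_curvature c b j x y z \<in> V"
  unfolding space_form_curvature_def by (intro membership j_closed)

lemma space_form_curvature_add:
  "x \<in> V \<Longrightarrow> y \<in> V \<Longrightarrow> z \<in> V \<Longrightarrow> w \<in> V \<Longrightarrow>
    space_form_curvature c b j x y (z + w) =
    space_form_curvature c b j x y z + space_form_curvature c b j x y w"
  unfolding space_form_curvature_def
  by (simp add: bilinear_simps j_closed j_simps algebra_simps)

lemma space_form_curvature_scale:
  "x \<in> V \<Longrightarrow> y \<in> V \<Longrightarrow> z \<in> V \<Longrightarrow>
    space_form_curvature c b j x y (r *\<^sub>R z) = r *\<^sub>R space_form_curvature c b j x y z"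
  unfolding space_form_curvature_def
  by (simp add: bilinear_simps j_closed j_simps algebra_simps)

text \<open>For the space form this is the counterpart of the parallelism of \<open>J\<close>: exchanging \<open>z\<close> for \<open>j z\<close>
  swaps the first two terms of the formula with the next two.\<close>

lemma space_form_curvature_commutes_j:
  "x \<in> V \<Longrightarrow> y \<in> V \<Longrightarrow> z \<in> V \<Longrightarrow>
    space_form_curvature c b j x y (j z) = j (space_form_curvature c b j x y z)"
  unfolding space_form_curvature_def
  by (simp add: bilinear_simps j_closed j_simps j_square j_isometry j_skew algebra_simps)

lemma space_form_curvature_skew:
  "x \<in> V \<Longrightarrow> y \<in> V \<Longrightarrow> z \<in> V \<Longrightarrow> w \<in> V \<Longrightarrow>
    b (space_form_curvature c b j x y z) w = - b z (space_form_curvature c b j x y w)"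
  unfolding space_form_curvature_def
  by (simp add: bilinear_simps j_closed j_skew commute[of z] algebra_simps)

end

section \<open>Smooth functions and vector fields\<close>

lemma Ck_on_const: "Ck_on n S (\<lambda>_. c)"
  by (induction n arbitrary: c) (auto simp: frechet_derivative_const)

text \<open>On an open set, derivatives are determined by the values on the set.\<close>

lemma Ck_on_cong:
  assumes "open S"
  shows "(\<And>x. x \<in> S \<Longrightarrow> f x = f' x) \<Longrightarrow> Ck_on n S f \<Longrightarrow> Ck_on n S f'"
proof (induction n arbitrary: f f')
  case 0
  then show ?case
    using continuous_on_cong[of S S f f'] by simp
next
  case (Suc n)
  have D: "(f' has_derivative frechet_derivative f (at x)) (at x)" if "x \<in> S" for x
  proof (rule has_derivative_transform_within_open[OF _ \<open>open S\<close> that])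
    show "(f has_derivative frechet_derivative f (at x)) (at x)"
      using Suc.prems(2) that by (simp add: frechet_derivative_works[symmetric])
  qed (rule Suc.prems(1))
  have "frechet_derivative f (at x) = frechet_derivative f' (at x)" if "x \<in> S" for x
    using frechet_derivative_at[OF D[OF that]] .
  moreover have "Ck_on n S (\<lambda>x. frechet_derivative f (at x) v)" for v
    using Suc.prems(2) by simp
  ultimately have "Ck_on n S (\<lambda>x. frechet_derivative f' (at x) v)" for v
    using Suc.IH[of "\<lambda>x. frechet_derivative f (at x) v" "\<lambda>x. frechet_derivative f' (at x) v"]
    by simp
  then show ?case
    using D by (auto simp: differentiable_def)
qed

lemma Ck_on_diff:
  assumes "open S"
  shows "Ck_on n S f \<Longrightarrow> Ck_on n S f' \<Longrightarrow> Ck_on n S (\<lambda>x. f x - f' x)"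
proof (induction n arbitrary: f f')
  case 0
  then show ?case
    by (simp add: continuous_on_diff)
next
  case (Suc n)
  have D: "((\<lambda>x. f x - f' x) has_derivative
      (\<lambda>v. frechet_derivative f (at x) v - frechet_derivative f' (at x) v)) (at x)"
    if "x \<in> S" for x
    using Suc.prems that by (intro has_derivative_diff) (auto simp: frechet_derivative_works[symmetric])
  then have eq: "frechet_derivative f (at x) v - frechet_derivative f' (at x) v =
      frechet_derivative (\<lambda>x. f x - f' x) (at x) v" if "x \<in> S" for x v
    by (simp add: frechet_derivative_at[OF D[OF that], symmetric])
  have "Ck_on n S (\<lambda>x. frechet_derivative f (at x) v - frechet_derivative f' (at x) v)" for v
    using Suc.prems by (intro Suc.IH) simp_all
  then have "Ck_on n S (\<lambda>x. frechet_derivative (\<lambda>x. f x - f' x) (at x) v)" for v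
    by (rule Ck_on_cong[OF \<open>open S\<close>, rotated]) (simp add: eq)
  then show ?case
    using D by (auto simp: differentiable_def)
qed

lemma zero_smooth_function: "(\<lambda>_. 0) \<in> smooth_functions \<A>"
  by (auto simp: smooth_functions_def smooth_map_on_def smooth_on_def comp_def Ck_on_const)

lemma smooth_functions_diff:
  assumes "smooth_surface \<A>" "f \<in> smooth_functions \<A>" "f' \<in> smooth_functions \<A>"
  shows "(\<lambda>p. f p - f' p) \<in> smooth_functions \<A>"
proof -
  have "smooth_on (\<phi> ` U) ((\<lambda>p. f p - f' p) \<circ> inv_into U \<phi>)" if "(U, \<phi>) \<in> \<A>" for U \<phi>
  proof -
    have "open (\<phi> ` U)"
      using assms(1) that by (auto simp: smooth_surface_def)
    then have "Ck_on n (\<phi> ` U) (\<lambda>x. f (inv_into U \<phi> x) - f' (inv_into U \<phi> x))" for n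
      using assms(2,3) that
      by (intro Ck_on_diff) (auto simp: smooth_functions_def smooth_map_on_def smooth_on_def comp_def)
    then show ?thesis
      by (simp add: smooth_on_def comp_def)
  qed
  then show ?thesis
    by (auto simp: smooth_functions_def smooth_map_on_def)
qed

lemma zero_vector_field: "(\<lambda>_. 0) \<in> vector_fields \<A>"
  by (simp add: vector_fields_def tangent_space_def zero_fun_def zero_smooth_function)

lemma tangent_space_diff:
  assumes "u \<in> tangent_space \<A> p" "v \<in> tangent_space \<A> p"
  shows "u - v \<in> tangent_space \<A> p"
proof -
  let ?S = "smooth_functions \<A>"
  have u: "u (\<lambda>q. f q + f' q) = u f + u f'" "u (\<lambda>q. f q * f' q) = u f * f' p + f p * u f'"
    "u (\<lambda>q. r * f q) = r * u f"
    and v: "v (\<lambda>q. f q + f' q) = v f + v f'" "v (\<lambda>q. f q * f' q) = v f * f' p + f p * v f'"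
    "v (\<lambda>q. r * f q) = r * v f"
    if "f \<in> ?S" "f' \<in> ?S" for f f' r
    using assms that by (auto simp only: tangent_space_def mem_Collect_eq)
  have "u f = 0" "v f = 0" if "f \<notin> ?S" for f
    using assms that by (auto simp only: tangent_space_def mem_Collect_eq)
  then show ?thesis
    by (simp add: tangent_space_def u v algebra_simps)
qed

lemma vector_fields_diff:
  assumes "smooth_surface \<A>" "X \<in> vector_fields \<A>" "Y \<in> vector_fields \<A>"
  shows "X - Y \<in> vector_fields \<A>"
  using assms by (simp add: vector_fields_def tangent_space_diff smooth_functions_diff)

lemma vector_field_add:
  assumes "X \<in> vector_fields \<A>" "f \<in> smooth_functions \<A>" "f' \<in> smooth_functions \<A>"
  shows "X p (\<lambda>q. f q + f' q) = X p f + X p f'"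
proof -
  have "X p \<in> tangent_space \<A> p"
    using assms by (simp add: vector_fields_def)
  then show ?thesis
    using assms by (simp only: tangent_space_def mem_Collect_eq)
qed


section \<open>The curvature of the sum connection\<close>

locale lorentzian_surface =
  fixes \<A> :: "'m::{t2_space, second_countable_topology} atlas"
    and g :: "'m \<Rightarrow> 'm tangent \<Rightarrow> 'm tangent \<Rightarrow> real"
    and N :: "'m vfield \<Rightarrow> 'm vfield \<Rightarrow> 'm vfield"
    and E :: "'m \<Rightarrow> 'v::real_vector set"
    and \<T> :: "('m, 'v) bundle_atlas"
    and k :: "'m \<Rightarrow> 'v \<Rightarrow> 'v \<Rightarrow> real"
    and D :: "'m vfield \<Rightarrow> ('m \<Rightarrow> 'v) \<Rightarrow> ('m \<Rightarrow> 'v)"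
    and h :: "'m \<Rightarrow> 'm tangent \<Rightarrow> 'm tangent \<Rightarrow> 'v"
    and J :: "'m \<Rightarrow> 'm tangent \<times> 'v \<Rightarrow> 'm tangent \<times> 'v"
  assumes surface_data: "lorentzian_surface_data \<A> g N E \<T> k D h J"
begin

abbreviation "T \<equiv> tangent_space \<A>"
abbreviation "VF \<equiv> vector_fields \<A>"
abbreviation "\<Gamma> \<equiv> sections \<A> E \<T>"
abbreviation "\<Gamma>\<^sub>s\<^sub>u\<^sub>m \<equiv> sum_sections \<A> E \<T>"
abbreviation "b \<equiv> sum_metric g k"
abbreviation "A \<equiv> shape_operator \<A> g k h"
abbreviation "\<D> \<equiv> sum_connection \<A> g N k D h"

lemma smooth_surface: "smooth_surface \<A>"
  and metric_g: "lorentzian_bundle_metric \<A> T VF g"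
  and levi_civita: "levi_civita \<A> g N"
  and metric_k: "lorentzian_bundle_metric \<A> E \<Gamma> k"
  and connection_D: "is_connection \<A> \<Gamma> D"
  and compatible_D: "metric_compatible \<A> \<Gamma> k D"
  and symmetric_h: "symmetric_bilinear_on (T p) (h p)"
  and h_normal: "x \<in> T p \<Longrightarrow> y \<in> T p \<Longrightarrow> h p x y \<in> E p"
  and h_section: "X \<in> VF \<Longrightarrow> Y \<in> VF \<Longrightarrow> (\<lambda>p. h p (X p) (Y p)) \<in> \<Gamma>"
  and J_linear: "linear_on_subspace (T p \<times> E p) (J p)"
  and J_closed: "u \<in> T p \<times> E p \<Longrightarrow> J p u \<in> T p \<times> E p"
  and J_square: "u \<in> T p \<times> E p \<Longrightarrow> J p (J p u) = - u"
  and J_isometry: "u \<in> T p \<times> E p \<Longrightarrow> w \<in> T p \<times> E p \<Longrightarrow> b p (J p u) (J p w) = b p u w"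
  and J_section: "U \<in> \<Gamma>\<^sub>s\<^sub>u\<^sub>m \<Longrightarrow> (\<lambda>p. J p (U p)) \<in> \<Gamma>\<^sub>s\<^sub>u\<^sub>m"
  and J_parallel: "X \<in> VF \<Longrightarrow> U \<in> \<Gamma>\<^sub>s\<^sub>u\<^sub>m \<Longrightarrow> \<D> X (\<lambda>q. J q (U q)) p = J p (\<D> X U p)"
  using surface_data unfolding lorentzian_surface_data_def by blast+

lemma vector_field_at: "X \<in> VF \<Longrightarrow> X p \<in> T p"
  by (simp add: vector_fields_def)

lemma section_at: "\<xi> \<in> \<Gamma> \<Longrightarrow> \<xi> p \<in> E p"
  by (simp add: sections_def)

lemma connection_N: "is_connection \<A> VF N"
  using levi_civita by (simp add: levi_civita_def)

lemma N_closed: "X \<in> VF \<Longrightarrow> Y \<in> VF \<Longrightarrow> N X Y \<in> VF"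
  using connection_N by (simp add: is_connection_def)

lemma D_closed: "X \<in> VF \<Longrightarrow> \<xi> \<in> \<Gamma> \<Longrightarrow> D X \<xi> \<in> \<Gamma>"
  using connection_D by (simp add: is_connection_def)

lemma D_add: "X \<in> VF \<Longrightarrow> \<xi> \<in> \<Gamma> \<Longrightarrow> \<eta> \<in> \<Gamma> \<Longrightarrow> D X (\<xi> + \<eta>) = D X \<xi> + D X \<eta>"
  using connection_D by (simp add: is_connection_def)

lemma lie_bracket_eq: "X \<in> VF \<Longrightarrow> Y \<in> VF \<Longrightarrow> lie_bracket X Y = N X Y - N Y X"
  using levi_civita by (simp add: levi_civita_def)

lemma lie_bracket_closed: "X \<in> VF \<Longrightarrow> Y \<in> VF \<Longrightarrow> lie_bracket X Y \<in> VF"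
  by (simp add: lie_bracket_eq vector_fields_diff[OF smooth_surface] N_closed)

sublocale tangent: lorentzian_plane "T p" "g p" for p
  using metric_g by unfold_locales (simp add: lorentzian_bundle_metric_def)

sublocale normal: lorentzian_plane "E p" "k p" for p
  using metric_k by unfold_locales (simp add: lorentzian_bundle_metric_def)

sublocale second_form: symmetric_bilinear_space "T p" "h p" for p
  by unfold_locales (rule tangent.subspace symmetric_h)+

sublocale total: hermitian_space "T p \<times> E p" "b p" "J p" for p
proof
  show "subspace (T p \<times> E p)"
    by (intro subspace_Times tangent.subspace normal.subspace)
  show "symmetric_bilinear_on (T p \<times> E p) (b p)"
    unfolding symmetric_bilinear_on_def linear_on_subspace_def sum_metric_def
    by (auto simp: tangent.bilinear_simps normal.bilinear_simps algebra_simps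
        intro!: arg_cong2[where f = "(+)"] intro: tangent.commute normal.commute)
qed (rule J_linear J_closed J_square J_isometry; assumption)+

text \<open>It is the second fundamental form of the zero vector field with itself.\<close>

lemma zero_section: "(\<lambda>_. 0) \<in> \<Gamma>"
  using h_section[OF zero_vector_field zero_vector_field]
  by (simp add: second_form.right tangent.membership)

lemma D_zero:
  assumes "X \<in> VF"
  shows "D X (\<lambda>_. 0) p = 0"
proof -
  have "(\<lambda>_. 0) + (\<lambda>_. 0) = (\<lambda>_ :: 'm. 0 :: 'v)"
    by (rule ext) simp
  then have "D X (\<lambda>_. 0) = D X (\<lambda>_. 0) + D X (\<lambda>_. 0)"
    using D_add[OF assms zero_section zero_section] by simp
  from fun_cong[OF this, of p] show ?thesis by simp
qed

lemma sum_section_at: "U \<in> \<Gamma>\<^sub>s\<^sub>u\<^sub>m \<Longrightarrow> U p \<in> T p \<times> E p"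
  using vector_field_at[of "fst \<circ> U" p] section_at[of "snd \<circ> U" p]
  by (simp add: sum_sections_def mem_Times_iff)

lemma shape_operator:
  assumes "\<zeta> \<in> E p" "x \<in> T p"
  shows "A p \<zeta> x \<in> T p" "\<And>y. y \<in> T p \<Longrightarrow> g p (A p \<zeta> x) y = k p (h p x y) \<zeta>"
proof -
  have "linear_on_subspace (T p) (\<lambda>y. k p (h p x y) \<zeta>)"
    unfolding linear_on_subspace_def using assms
    by (auto simp: second_form.right normal.left h_normal)
  from theI'[OF tangent.representation[OF this]]
  show "A p \<zeta> x \<in> T p" "\<And>y. y \<in> T p \<Longrightarrow> g p (A p \<zeta> x) y = k p (h p x y) \<zeta>"
    unfolding shape_operator_def by auto
qed

lemma shape_operator_scale:
  assumes "\<zeta> \<in> E p" "x \<in> T p"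
  shows "A p (r *\<^sub>R \<zeta>) x = r *\<^sub>R A p \<zeta> x"
  using assms
  by (intro tangent.nondegenerate[where p = p])
    (simp_all add: shape_operator tangent.bilinear_simps normal.bilinear_simps h_normal)

lemma shape_operator_zero: "x \<in> T p \<Longrightarrow> A p 0 x = 0"
  using shape_operator_scale[of 0 p x 0] by (simp add: normal.membership)

lemma sum_connection_at:
  "X \<in> VF \<Longrightarrow> U \<in> \<Gamma>\<^sub>s\<^sub>u\<^sub>m \<Longrightarrow> \<D> X U p \<in> T p \<times> E p"
  using sum_section_at[of U p]
  by (simp add: sum_connection_def sum_sections_def mem_Times_iff tangent.membership
      normal.membership shape_operator h_normal vector_field_at section_at N_closed D_closed)

lemma tangent_section: "Z \<in> VF \<Longrightarrow> (\<lambda>p. (Z p, 0)) \<in> \<Gamma>\<^sub>s\<^sub>u\<^sub>m"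
  using zero_section by (simp add: sum_sections_def comp_def)

lemma normal_section: "\<xi> \<in> \<Gamma> \<Longrightarrow> (\<lambda>p. (0, \<xi> p)) \<in> \<Gamma>\<^sub>s\<^sub>u\<^sub>m"
  using zero_vector_field[of \<A>] by (simp add: sum_sections_def comp_def)

text \<open>On tangent sections no shape operator enters, so the result is visibly a smooth section. With a
  normal part, smoothness would rest on that of the shape operator, hence on local frames.\<close>

lemma sum_connection_tangent:
  assumes "X \<in> VF"
  shows "\<D> X (\<lambda>p. (Z p, 0)) = (\<lambda>p. (N X Z p, h p (X p) (Z p)))"
  using D_zero[OF assms] vector_field_at[OF assms]
  by (simp add: sum_connection_def comp_def shape_operator_zero)

lemma sum_connection_tangent_closed:
  assumes "X \<in> VF" "Z \<in> VF"
  shows "\<D> X (\<lambda>p. (Z p, 0)) \<in> \<Gamma>\<^sub>s\<^sub>u\<^sub>m"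
  using assms by (simp add: sum_connection_tangent sum_sections_def comp_def N_closed h_section)

text \<open>Parallelism of \<open>J\<close> is applied twice, the second time to a first derivative of \<open>U\<close>; for this the
  derivatives have to be sections.\<close>

lemma curvature_commutes_J:
  assumes "X \<in> VF" "Y \<in> VF" "U \<in> \<Gamma>\<^sub>s\<^sub>u\<^sub>m" "\<D> X U \<in> \<Gamma>\<^sub>s\<^sub>u\<^sub>m" "\<D> Y U \<in> \<Gamma>\<^sub>s\<^sub>u\<^sub>m"
  shows "curvature \<D> X Y (\<lambda>q. J q (U q)) p = J p (curvature \<D> X Y U p)"
proof -
  have "\<D> V (\<lambda>q. J q (U q)) = (\<lambda>q. J q (\<D> V U q))" if "V \<in> VF" for V
    using J_parallel that assms(3) by blast
  then show ?thesis
    using assms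
    by (simp add: curvature_def J_parallel lie_bracket_closed total.j_simps sum_connection_at
        total.membership)
qed

lemma curvature_D_at:
  "X \<in> VF \<Longrightarrow> Y \<in> VF \<Longrightarrow> \<xi> \<in> \<Gamma> \<Longrightarrow> curvature D X Y \<xi> p \<in> E p"
  by (simp add: curvature_def normal.membership section_at D_closed lie_bracket_closed)

text \<open>Differentiate \<open>k \<xi> \<eta>\<close> in the order \<open>X Y\<close>, then \<open>Y X\<close>, and subtract the derivative along the
  bracket: the total is zero, and the products of two first derivatives cancel.\<close>

lemma curvature_D_skew:
  assumes "X \<in> VF" "Y \<in> VF" "\<xi> \<in> \<Gamma>" "\<eta> \<in> \<Gamma>"
  shows "k p (curvature D X Y \<xi> p) (\<eta> p) = - k p (\<xi> p) (curvature D X Y \<eta> p)"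
proof -
  have smooth: "(\<lambda>q. k q (s q) (t q)) \<in> smooth_functions \<A>" if "s \<in> \<Gamma>" "t \<in> \<Gamma>" for s t
    using metric_k that by (simp add: lorentzian_bundle_metric_def)
  have deriv: "V q (\<lambda>q. k q (s q) (t q)) = k q (D V s q) (t q) + k q (s q) (D V t q)"
    if "V \<in> VF" "s \<in> \<Gamma>" "t \<in> \<Gamma>" for V s t q
    using compatible_D that by (simp add: metric_compatible_def)
  have second: "V p (\<lambda>q. W q (\<lambda>q. k q (\<xi> q) (\<eta> q))) =
      k p (D V (D W \<xi>) p) (\<eta> p) + k p (D W \<xi> p) (D V \<eta> p) +
      (k p (D V \<xi> p) (D W \<eta> p) + k p (\<xi> p) (D V (D W \<eta>) p))"
    if "V \<in> VF" "W \<in> VF" for V W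
    using vector_field_add[OF that(1) smooth smooth] that assms by (simp add: deriv D_closed)
  have "lie_bracket X Y p (\<lambda>q. k q (\<xi> q) (\<eta> q)) =
      X p (\<lambda>q. Y q (\<lambda>q. k q (\<xi> q) (\<eta> q))) - Y p (\<lambda>q. X q (\<lambda>q. k q (\<xi> q) (\<eta> q)))"
    by (simp add: lie_bracket_def)
  then have "k p (D (lie_bracket X Y) \<xi> p) (\<eta> p) + k p (\<xi> p) (D (lie_bracket X Y) \<eta> p) =
      k p (D X (D Y \<xi>) p) (\<eta> p) + k p (\<xi> p) (D X (D Y \<eta>) p) -
      (k p (D Y (D X \<xi>) p) (\<eta> p) + k p (\<xi> p) (D Y (D X \<eta>) p))"
    unfolding deriv[OF lie_bracket_closed[OF assms(1,2)] assms(3,4)]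
      second[OF assms(1,2)] second[OF assms(2,1)] by simp
  then show ?thesis
    using assms lie_bracket_closed[OF assms(1,2)]
    by (simp add: curvature_def normal.bilinear_simps section_at D_closed)
qed

text \<open>The connection \<open>N\<close> is torsion-free, which turns the bracket into the terms of the covariant
  derivatives of \<open>h\<close>.\<close>

lemma snd_curvature_tangent:
  assumes "X \<in> VF" "Y \<in> VF" "Z \<in> VF"
  shows "snd (curvature \<D> X Y (\<lambda>p. (Z p, 0)) p) =
    covariant_deriv_h N D h X Y Z p - covariant_deriv_h N D h Y X Z p"
proof -
  have "snd (\<D> V (\<D> W (\<lambda>p. (Z p, 0))) p) =
      h p (V p) (N W Z p) + D V (\<lambda>q. h q (W q) (Z q)) p" if "V \<in> VF" "W \<in> VF" for V W
    using that by (simp add: sum_connection_tangent) (simp add: sum_connection_def comp_def)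
  then show ?thesis
    using assms lie_bracket_closed[OF assms(1,2)]
    by (simp add: curvature_def covariant_deriv_h_def sum_connection_tangent lie_bracket_eq
        second_form.bilinear_simps vector_field_at N_closed algebra_simps)
qed

lemma fst_curvature_tangent:
  assumes "X \<in> VF" "Y \<in> VF" "Z \<in> VF" "w \<in> T p"
  shows "g p (fst (curvature \<D> X Y (\<lambda>p. (Z p, 0)) p)) w =
    g p (curvature N X Y Z p) w
    - k p (h p (X p) w) (h p (Y p) (Z p)) + k p (h p (X p) (Z p)) (h p (Y p) w)"
proof -
  have "fst (\<D> V (\<D> W (\<lambda>p. (Z p, 0))) p) =
      N V (N W Z) p - A p (h p (W p) (Z p)) (V p)" if "V \<in> VF" "W \<in> VF" for V W
    using that by (simp add: sum_connection_tangent) (simp add: sum_connection_def comp_def)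
  then show ?thesis
    using assms lie_bracket_closed[OF assms(1,2)]
    by (simp add: curvature_def sum_connection_tangent tangent.bilinear_simps shape_operator
        h_normal vector_field_at N_closed normal.commute[of "h p (X p) (Z p)"])
qed

text \<open>The tangent part \<open>Z\<close> is split off here at the level of values: \<open>(\<lambda>p. (Z p, \<zeta> p))\<close> is
  differentiated as a whole, and in the normal part the shape operator of \<open>\<zeta>\<close> is only evaluated at
  the point, never differentiated.\<close>

lemma snd_curvature:
  assumes "X \<in> VF" "Y \<in> VF" "Z \<in> VF" "\<zeta> \<in> \<Gamma>"
  shows "snd (curvature \<D> X Y (\<lambda>p. (Z p, \<zeta> p)) p) =
    snd (curvature \<D> X Y (\<lambda>p. (Z p, 0)) p) + curvature D X Y \<zeta> p
    - h p (X p) (A p (\<zeta> p) (Y p)) + h p (Y p) (A p (\<zeta> p) (X p))"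
proof -
  have full: "snd (\<D> V (\<D> W (\<lambda>p. (Z p, \<zeta> p))) p) =
      snd (\<D> V (\<D> W (\<lambda>p. (Z p, 0))) p) + D V (D W \<zeta>) p
      - h p (V p) (A p (\<zeta> p) (W p))" if "V \<in> VF" "W \<in> VF" for V W
  proof -
    have "D V (\<lambda>q. h q (W q) (Z q) + D W \<zeta> q) p = D V (\<lambda>q. h q (W q) (Z q)) p + D V (D W \<zeta>) p"
      using D_add[OF that(1) h_section[OF that(2) assms(3)] D_closed[OF that(2) assms(4)]]
      by (simp add: plus_fun_def)
    then show ?thesis
      using that assms
      by (simp add: sum_connection_tangent)
        (simp add: sum_connection_def comp_def second_form.bilinear_simps vector_field_at
          N_closed shape_operator section_at)
  qed
  have "snd (\<D> V (\<lambda>p. (Z p, \<zeta> p)) p) = snd (\<D> V (\<lambda>p. (Z p, 0)) p) + D V \<zeta> p" if "V \<in> VF" for V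
    using that by (simp add: sum_connection_tangent) (simp add: sum_connection_def comp_def)
  then show ?thesis
    using assms lie_bracket_closed[OF assms(1,2)] by (simp add: curvature_def full)
qed


section \<open>The equation of Ricci\<close>

lemma J_tangent_field: "U \<in> \<Gamma>\<^sub>s\<^sub>u\<^sub>m \<Longrightarrow> (\<lambda>p. fst (J p (U p))) \<in> VF"
  using J_section[of U] by (simp add: sum_sections_def comp_def)

lemma J_normal_section: "U \<in> \<Gamma>\<^sub>s\<^sub>u\<^sub>m \<Longrightarrow> (\<lambda>p. snd (J p (U p))) \<in> \<Gamma>"
  using J_section[of U] by (simp add: sum_sections_def comp_def)

text \<open>The tangential part of \<open>J\<close> loses nothing on normal vectors: applying \<open>J\<close> to it gives back a
  nonzero multiple of the vector as normal part.\<close>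

lemma normal_part_of_J_tangent_part:
  "\<exists>r. r \<noteq> 0 \<and> (\<forall>\<eta>\<in>E p. snd (J p (fst (J p (0, \<eta>)), 0)) = r *\<^sub>R \<eta>)"
proof -
  define Q where "Q \<eta> = snd (J p (0, \<eta>))" for \<eta>
  have mem: "(0, \<eta>) \<in> T p \<times> E p" if "\<eta> \<in> E p" for \<eta>
    using that by (simp add: tangent.membership)
  have J_mem: "fst (J p (0, \<eta>)) \<in> T p" "Q \<eta> \<in> E p" if "\<eta> \<in> E p" for \<eta>
    using J_closed[OF mem[OF that]] by (auto simp: Q_def mem_Times_iff)
  have linear: "linear_on_subspace (E p) Q"
    unfolding linear_on_subspace_def
  proof (intro conjI ballI allI)
    fix x y r assume "x \<in> E p" "y \<in> E p"
    then show "Q (x + y) = Q x + Q y" "Q (r *\<^sub>R x) = r *\<^sub>R Q x"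
      using total.j_simps(1)[OF mem mem, of x y] total.j_simps(3)[OF mem, of x r]
      by (simp_all add: Q_def)
  qed
  have "k p (Q x) y = - k p x (Q y)" if "x \<in> E p" "y \<in> E p" for x y
    using total.j_skew[OF mem mem, OF that] that J_mem
    by (simp add: sum_metric_def Q_def tangent.bilinear_simps)
  then obtain \<beta> where \<beta>: "\<And>x. x \<in> E p \<Longrightarrow> Q (Q x) = \<beta>\<^sup>2 *\<^sub>R x"
    using normal.skew_operator_square[OF linear J_mem(2)] by blast
  have "snd (J p (fst (J p (0, \<eta>)), 0)) = (- 1 - \<beta>\<^sup>2) *\<^sub>R \<eta>" if "\<eta> \<in> E p" for \<eta>
  proof -
    have split: "J p (0, \<eta>) = (fst (J p (0, \<eta>)), 0) + (0, Q \<eta>)"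
      by (simp add: Q_def)
    have "J p (J p (0, \<eta>)) = J p (fst (J p (0, \<eta>)), 0) + J p (0, Q \<eta>)"
      using J_mem[OF that]
      by (subst split) (simp only: total.j_simps mem_Times_iff fst_conv snd_conv
          tangent.membership normal.membership simp_thms)
    then have "snd (J p (fst (J p (0, \<eta>)), 0)) + \<beta>\<^sup>2 *\<^sub>R \<eta> = - \<eta>"
      using J_square[OF mem[OF that]] \<beta>[OF that] by (simp add: Q_def prod_eq_iff)
    then show ?thesis
      by (simp add: algebra_simps eq_diff_eq)
  qed
  moreover have "- 1 - \<beta>\<^sup>2 \<noteq> 0"
    using zero_le_power2[of \<beta>] by linarith
  ultimately show ?thesis by blast
qed

text \<open>The normal part of \<open>C(X, Y) (J Z) = J (C(X, Y) Z)\<close>, with Gauss and Codazzi inserted for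
  \<open>C(X, Y) Z\<close>, where \<open>C\<close> is the curvature of \<open>\<D>\<close>. The terms with shape operators are the
  commutator in the equation of Ricci, written through \<open>h\<close>.\<close>

lemma ricci_for_normal_part:
  assumes "gauss_equation c \<A> g N k h J" "codazzi_equation c \<A> g N k D h J"
    and X: "X \<in> VF" and Y: "Y \<in> VF" and Z: "Z \<in> VF" and \<xi>: "\<xi> \<in> \<Gamma>"
  defines "\<zeta> \<equiv> (\<lambda>q. snd (J q (Z q, 0)))"
  shows "k p (curvature D X Y \<zeta> p) (\<xi> p) =
    b p (space_form_curvature c (b p) (J p) (X p, 0) (Y p, 0) (0, \<zeta> p)) (0, \<xi> p)
    + (k p (h p (X p) (A p (\<zeta> p) (Y p))) (\<xi> p) - k p (h p (Y p) (A p (\<zeta> p) (X p))) (\<xi> p))"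
proof -
  define \<rho> where "\<rho> = curvature \<D> X Y (\<lambda>q. (Z q, 0)) p"
  define R where "R = space_form_curvature c (b p) (J p) (X p, 0) (Y p, 0)"
  define W where "W = (\<lambda>q. fst (J q (Z q, 0)))"
  define W' where "W' = (\<lambda>q. fst (J q (0, \<xi> q)))"
  have W: "W \<in> VF" and \<zeta>: "\<zeta> \<in> \<Gamma>" and W': "W' \<in> VF"
    using J_tangent_field[OF tangent_section[OF Z]] J_normal_section[OF tangent_section[OF Z]]
      J_tangent_field[OF normal_section[OF \<xi>]]
    by (simp_all add: W_def \<zeta>_def W'_def)
  have tan: "(V p, 0) \<in> T p \<times> E p" if "V \<in> VF" for V
    using that by (simp add: vector_field_at normal.membership)
  have nor: "(0, \<eta> p) \<in> T p \<times> E p" if "\<eta> \<in> \<Gamma>" for \<eta>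
    using that by (simp add: section_at tangent.membership)
  have R_mem: "R u \<in> T p \<times> E p" if "u \<in> T p \<times> E p" for u
    unfolding R_def by (rule total.space_form_curvature_closed[OF tan tan that]) fact+
  have \<rho>_mem: "\<rho> \<in> T p \<times> E p"
    unfolding \<rho>_def curvature_def
    using X Y Z by (simp only: minus_apply) (intro total.membership sum_connection_at
        sum_connection_tangent_closed tangent_section lie_bracket_closed)
  have J\<xi>: "J p (0, \<xi> p) \<in> T p \<times> E p"
    by (rule J_closed[OF nor[OF \<xi>]])
  have codazzi: "snd (curvature \<D> X Y (\<lambda>q. (V q, 0)) p) = snd (R (V p, 0))" if "V \<in> VF" for V
    using assms(2) snd_curvature_tangent[OF X Y that] X Y that
    by (simp add: codazzi_equation_def R_def)
  \<comment> \<open>By Gauss and Codazzi, \<open>\<rho>\<close> and \<open>R (Z p, 0)\<close> pair equally with vectors whose tangential part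
    extends to a vector field; \<open>J p (0, \<xi> p)\<close> is one.\<close>
  have "g p (fst \<rho>) (W' p) = b p (R (Z p, 0)) (W' p, 0)"
    using assms(1) fst_curvature_tangent[OF X Y Z vector_field_at[OF W'], of p] X Y Z W'
    by (simp add: gauss_equation_def \<rho>_def R_def)
  also have "\<dots> = g p (fst (R (Z p, 0))) (W' p)"
    using R_mem[OF tan[OF Z]] by (simp add: sum_metric_def normal.right mem_Times_iff)
  finally have "b p \<rho> (J p (0, \<xi> p)) = b p (R (Z p, 0)) (J p (0, \<xi> p))"
    using codazzi[OF Z] by (simp add: sum_metric_def W'_def \<rho>_def)
  then have "b p (J p \<rho>) (0, \<xi> p) = b p (J p (R (Z p, 0))) (0, \<xi> p)"
    using \<rho>_mem R_mem[OF tan[OF Z]] nor[OF \<xi>] by (simp add: total.j_skew)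
  also have "J p (R (Z p, 0)) = R ((W p, 0) + (0, \<zeta> p))"
    unfolding R_def using total.space_form_curvature_commutes_j[OF tan tan tan, OF X Y Z, symmetric]
    by (simp add: W_def \<zeta>_def)
  also have "\<dots> = R (W p, 0) + R (0, \<zeta> p)"
    unfolding R_def
    by (rule total.space_form_curvature_add[OF tan tan tan nor, OF X Y W \<zeta>])
  also have "b p \<dots> (0, \<xi> p) = b p (R (W p, 0)) (0, \<xi> p) + b p (R (0, \<zeta> p)) (0, \<xi> p)"
    by (rule total.left(1)[OF nor[OF \<xi>] R_mem[OF tan[OF W]] R_mem[OF nor[OF \<zeta>]]])
  also have "b p (R (W p, 0)) (0, \<xi> p) = k p (snd (R (W p, 0))) (\<xi> p)"
    using R_mem[OF tan[OF W]] by (simp add: sum_metric_def tangent.right mem_Times_iff)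
  also have "b p (J p \<rho>) (0, \<xi> p) = k p (snd (J p \<rho>)) (\<xi> p)"
    using J_closed[OF \<rho>_mem] by (simp add: sum_metric_def tangent.right mem_Times_iff)
  also have "J p \<rho> = curvature \<D> X Y (\<lambda>q. (W q, \<zeta> q)) p"
    using curvature_commutes_J[OF X Y tangent_section[OF Z] sum_connection_tangent_closed[OF X Z]
        sum_connection_tangent_closed[OF Y Z], of p]
    by (simp add: W_def \<zeta>_def \<rho>_def)
  also have "snd \<dots> = snd (R (W p, 0)) + curvature D X Y \<zeta> p
      - h p (X p) (A p (\<zeta> p) (Y p)) + h p (Y p) (A p (\<zeta> p) (X p))"
    by (simp add: snd_curvature[OF X Y W \<zeta>] codazzi[OF W])
  finally have eq: "k p (snd (R (W p, 0)) + curvature D X Y \<zeta> p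
        - h p (X p) (A p (\<zeta> p) (Y p)) + h p (Y p) (A p (\<zeta> p) (X p))) (\<xi> p) =
      k p (snd (R (W p, 0))) (\<xi> p) + b p (R (0, \<zeta> p)) (0, \<xi> p)" .
  have "snd (R (W p, 0)) \<in> E p" "curvature D X Y \<zeta> p \<in> E p"
    "h p (X p) (A p (\<zeta> p) (Y p)) \<in> E p" "h p (Y p) (A p (\<zeta> p) (X p)) \<in> E p" "\<xi> p \<in> E p"
    using R_mem[OF tan[OF W]] X Y \<zeta> \<xi> lie_bracket_closed[OF X Y]
    by (simp_all add: mem_Times_iff curvature_def normal.membership section_at D_closed h_normal
        vector_field_at shape_operator)
  with eq show ?thesis
    unfolding R_def[symmetric] by (simp add: normal.bilinear_simps)
qed

text \<open>For the pair \<open>\<xi>, \<eta>\<close> the previous lemma is used with \<open>Z\<close> the tangential part of \<open>J \<eta>\<close>. At the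
  point, the resulting \<open>\<zeta>\<close> is \<open>r \<eta>\<close> with \<open>r \<noteq> 0\<close>; all terms other than the curvature of \<open>D\<close> are
  pointwise and linear in \<open>\<zeta>\<close>, and the curvature term becomes so once skew symmetry has moved
  \<open>\<zeta>\<close> out of it.\<close>

lemma ricci:
  assumes "gauss_equation c \<A> g N k h J" "codazzi_equation c \<A> g N k D h J"
  shows "ricci_equation c \<A> g E \<T> k D h J"
  unfolding ricci_equation_def Let_def
proof (intro ballI allI)
  fix X Y \<xi> \<eta> p
  assume X: "X \<in> VF" and Y: "Y \<in> VF" and \<xi>: "\<xi> \<in> \<Gamma>" and \<eta>: "\<eta> \<in> \<Gamma>"
  define R where "R = space_form_curvature c (b p) (J p) (X p, 0) (Y p, 0)"
  define Z where "Z = (\<lambda>q. fst (J q (0, \<eta> q)))"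
  define \<zeta> where "\<zeta> = (\<lambda>q. snd (J q (Z q, 0)))"
  have Z: "Z \<in> VF"
    unfolding Z_def by (rule J_tangent_field[OF normal_section[OF \<eta>]])
  have \<zeta>: "\<zeta> \<in> \<Gamma>"
    unfolding \<zeta>_def by (rule J_normal_section[OF tangent_section[OF Z]])
  have xy: "X p \<in> T p" "Y p \<in> T p" "\<xi> p \<in> E p" "\<eta> p \<in> E p" "\<zeta> p \<in> E p"
    using X Y \<xi> \<eta> \<zeta> by (simp_all add: vector_field_at section_at)
  then have mem: "(X p, 0) \<in> T p \<times> E p" "(Y p, 0) \<in> T p \<times> E p" "(0, \<xi> p) \<in> T p \<times> E p"
    "(0, \<eta> p) \<in> T p \<times> E p"
    by (simp_all add: tangent.membership normal.membership)
  obtain r where r: "r \<noteq> 0" "\<zeta> p = r *\<^sub>R \<eta> p"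
    using normal_part_of_J_tangent_part[of p] xy(4) unfolding \<zeta>_def Z_def by blast
  have ricci_\<zeta>: "k p (curvature D X Y \<zeta> p) (\<xi> p) = b p (R (0, \<zeta> p)) (0, \<xi> p)
      + (k p (h p (X p) (A p (\<zeta> p) (Y p))) (\<xi> p) - k p (h p (Y p) (A p (\<zeta> p) (X p))) (\<xi> p))"
    using ricci_for_normal_part[OF assms X Y Z \<xi>, of p] by (simp add: R_def \<zeta>_def)
  have "r * k p (curvature D X Y \<xi> p) (\<eta> p) = k p (curvature D X Y \<xi> p) (\<zeta> p)"
    using xy by (simp add: r normal.right curvature_D_at[OF X Y \<xi>])
  also have "\<dots> = - k p (curvature D X Y \<zeta> p) (\<xi> p)"
    using curvature_D_skew[OF X Y \<xi> \<zeta>, of p]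
      normal.commute[OF curvature_D_at[OF X Y \<zeta>] xy(3)] by simp
  also have "\<dots> = - b p (R (0, r *\<^sub>R \<eta> p)) (0, \<xi> p)
      - (k p (h p (X p) (A p (r *\<^sub>R \<eta> p) (Y p))) (\<xi> p)
        - k p (h p (Y p) (A p (r *\<^sub>R \<eta> p) (X p))) (\<xi> p))"
    using ricci_\<zeta>[unfolded r(2)] by simp
  finally have scaled: "r * k p (curvature D X Y \<xi> p) (\<eta> p) =
      - b p (R (0, r *\<^sub>R \<eta> p)) (0, \<xi> p)
      - (k p (h p (X p) (A p (r *\<^sub>R \<eta> p) (Y p))) (\<xi> p)
        - k p (h p (Y p) (A p (r *\<^sub>R \<eta> p) (X p))) (\<xi> p))" .
  have R_swap: "b p (R (0, r *\<^sub>R \<eta> p)) (0, \<xi> p) = - r * b p (R (0, \<xi> p)) (0, \<eta> p)"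
  proof -
    have "R (0, r *\<^sub>R \<eta> p) = r *\<^sub>R R (0, \<eta> p)"
      using total.space_form_curvature_scale[OF mem(1,2,4), of c r] by (simp add: R_def)
    moreover have "R (0, \<xi> p) \<in> T p \<times> E p" "R (0, \<eta> p) \<in> T p \<times> E p"
      unfolding R_def by (rule total.space_form_curvature_closed[OF mem(1,2)]; fact mem)+
    ultimately show ?thesis
      using total.space_form_curvature_skew[OF mem(1,2,4,3), of c] total.left(4)[OF mem(3)]
        total.commute[OF mem(4)]
      by (simp add: R_def)
  qed
  have A\<eta>A\<xi>: "k p (h p (X p) (A p (r *\<^sub>R \<eta> p) (Y p))) (\<xi> p) =
      r * g p (A p (\<eta> p) (A p (\<xi> p) (X p))) (Y p)"
  proof -
    have "k p (h p (X p) (A p (\<eta> p) (Y p))) (\<xi> p) = g p (A p (\<xi> p) (X p)) (A p (\<eta> p) (Y p))"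
      using xy by (simp add: shape_operator)
    also have "\<dots> = g p (A p (\<eta> p) (Y p)) (A p (\<xi> p) (X p))"
      using xy by (simp add: shape_operator tangent.commute)
    also have "\<dots> = k p (h p (Y p) (A p (\<xi> p) (X p))) (\<eta> p)"
      using xy by (simp add: shape_operator)
    also have "h p (Y p) (A p (\<xi> p) (X p)) = h p (A p (\<xi> p) (X p)) (Y p)"
      using xy by (simp add: shape_operator second_form.commute)
    finally show ?thesis
      using xy by (simp add: shape_operator_scale second_form.right normal.left shape_operator
          h_normal)
  qed
  have A\<xi>A\<eta>: "k p (h p (Y p) (A p (r *\<^sub>R \<eta> p) (X p))) (\<xi> p) =
      r * g p (A p (\<xi> p) (A p (\<eta> p) (X p))) (Y p)"
    using xy second_form.commute[OF xy(2) shape_operator(1)[OF xy(4,1)]]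
    by (simp add: shape_operator_scale second_form.right normal.left shape_operator h_normal)
  have "r * k p (curvature D X Y \<xi> p) (\<eta> p) =
      r * (b p (R (0, \<xi> p)) (0, \<eta> p)
        + (g p (A p (\<xi> p) (A p (\<eta> p) (X p))) (Y p) - g p (A p (\<eta> p) (A p (\<xi> p) (X p))) (Y p)))"
    unfolding scaled R_swap A\<eta>A\<xi> A\<xi>A\<eta> by (simp only: right_diff_distrib distrib_left)
  then show "k p (curvature D X Y \<xi> p) (\<eta> p) =
      b p (space_form_curvature c (b p) (J p) (X p, 0) (Y p, 0) (0, \<xi> p)) (0, \<eta> p)
      + g p (A p (\<xi> p) (A p (\<eta> p) (X p)) - A p (\<eta> p) (A p (\<xi> p) (X p))) (Y p)"
    using r(1) xy by (simp add: R_def tangent.left shape_operator)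
qed

end

theorem theorem4p1:
  fixes \<A> :: "'m::{t2_space, second_countable_topology} atlas"
    and g :: "'m \<Rightarrow> 'm tangent \<Rightarrow> 'm tangent \<Rightarrow> real"
    and N :: "'m vfield \<Rightarrow> 'm vfield \<Rightarrow> 'm vfield"
    and E :: "'m \<Rightarrow> 'v::real_vector set"
    and \<T> :: "('m, 'v) bundle_atlas"
    and k :: "'m \<Rightarrow> 'v \<Rightarrow> 'v \<Rightarrow> real"
    and D :: "'m vfield \<Rightarrow> ('m \<Rightarrow> 'v) \<Rightarrow> ('m \<Rightarrow> 'v)"
    and h :: "'m \<Rightarrow> 'm tangent \<Rightarrow> 'm tangent \<Rightarrow> 'v"
    and J :: "'m \<Rightarrow> 'm tangent \<times> 'v \<Rightarrow> 'm tangent \<times> 'v"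
    and c :: real
  assumes "lorentzian_surface_data \<A> g N E \<T> k D h J"
    and "flat \<A> N"
    and "minimal \<A> g h"
    and "gauss_equation c \<A> g N k h J"
    and "codazzi_equation c \<A> g N k D h J"
  shows "ricci_equation c \<A> g E \<T> k D h J"
proof -
  interpret lorentzian_surface \<A> g N E \<T> k D h J
    by unfold_locales fact
  show ?thesis
    using assms by (intro ricci)
qed

end
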